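(* Let $n\ge 1$. A transposition $\delta_{i,j,k}$ (with $1\le i<j<k\le n+1$) is a tree transposition if and only if it is a $1$-transposition, i.e. $j=i+1$ or $k=j+1$.
   Context: For a permutation $\sigma$ of $[n]$ (viewed as the sequence $\sigma(1),\dots,\sigma(n)$) and integers $1\le i<j<k\le n+1$, let $q=k+i-j$; the transposition $\delta_{i,j,k}$ applied to $\sigma$ gives the sequence $\delta$ with $\delta(t)=\sigma(t)$ for $1\le t<i$, $\delta(t)=\sigma(t+j-i)$ for $i\le t<q$, $\delta(t)=\sigma(t+j-k)$ for $q\le t<k$, and $\delta(t)=\sigma(t)$ for $k\le t\le n$ (i.e. it swaps the consecutive blocks $\sigma(i..j-1)$ and $\sigma(j..k-1)$). It is a $1$-transposition if $j=i+1$ or $k=j+1$. A full binary tree is a rooted ordered tree in which every node is either a leaf or an internal node with exactly two children. Given one with $n$ internal nodes, label its internal nodes $1,\dots,n$ so that the in-order traversal is $1,\dots,n$; its associated permutation is the sequence of labels in pre-order traversal. A rotation: a right rotation at an internal node $a$ whose left child $b$ is internal, with $C,D$ the subtrees of $b$ and $E$ the right subtree of $a$, replaces the subtree at $a$ by the tree with root $b$, left subtree $C$, right child $a$ having subtrees $D,E$; a left rotation is the inverse. The rotation distance $d(T_1,T_2)$ is the minimum number of rotations transforming $T_1$ into $T_2$. A transposition $\delta_{i,j,k}$ is a tree transposition if there exist full binary trees $T_1,T_2$ with $n$ internal nodes and associated permutations $\sigma,\tau$ such that $d(T_1,T_2)=1$ and applying $\delta_{i,j,k}$ to $\sigma$ yields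 $\tau$. *)

theory Defs
  imports "HOL-Library.Tree" "HOL-Library.Extended_Nat"
begin

text \<open>A full binary tree is represented by its shape, a \<^typ>\<open>unit tree\<close>: the leaves are the
  occurrences of \<^const>\<open>Leaf\<close>, the internal nodes those of \<^const>\<open>Node\<close>, so that \<^const>\<open>size\<close>
  counts the internal nodes.\<close>

type_synonym full_tree = "unit tree"

fun label_from :: "nat \<Rightarrow> full_tree \<Rightarrow> nat tree" where
  "label_from m Leaf = Leaf"
| "label_from m (Node l u r) =
     Node (label_from m l) (m + size l) (label_from (Suc (m + size l)) r)"

text \<open>The next two facts characterise the labelling: it keeps the shape and its in-order
  traversal is the interval starting at the given number.\<close>

lemma shape_label_from: "map_tree (\<lambda>_. ()) (label_from m t) = t"
  by (induction t arbitrary: m) auto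

lemma inorder_label_from: "inorder (label_from m t) = [m..<m + size t]"
proof (induction t arbitrary: m)
  case (Node l u r)
  have "[m..<m + size (Node l u r)]
      = [m..<m + size l] @ [m + size l..<m + size l + Suc (size r)]"
    using upt_add_eq_append[of m "m + size l" "Suc (size r)"] by (simp add: add.assoc)
  also have "[m + size l..<m + size l + Suc (size r)]
      = (m + size l) # [Suc (m + size l)..<Suc (m + size l) + size r]"
    by (subst upt_conv_Cons) auto
  finally show ?case
    by (simp only: label_from.simps inorder.simps Node.IH append_Cons append_Nil)
qed simp

definition associated_permutation :: "full_tree \<Rightarrow> nat list" where
  "associated_permutation t = preorder (label_from 1 t)"

inductive right_rotation :: "'a tree \<Rightarrow> 'a tree \<Rightarrow> bool" where
  at_root: "right_rotation (Node (Node C b D) a E) (Node C b (Node D a E))"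
| in_left: "right_rotation l l' \<Longrightarrow> right_rotation (Node l a r) (Node l' a r)"
| in_right: "right_rotation r r' \<Longrightarrow> right_rotation (Node l a r) (Node l a r')"

definition rotation :: "'a tree \<Rightarrow> 'a tree \<Rightarrow> bool" where
  "rotation T T' \<longleftrightarrow> right_rotation T T' \<or> right_rotation T' T"

text \<open>The value is \<open>\<infinity>\<close> if no sequence of rotations leads from the first tree to the second.\<close>

definition rotation_distance :: "'a tree \<Rightarrow> 'a tree \<Rightarrow> enat" where
  "rotation_distance T T' = (INF m \<in> {m. (rotation ^^ m) T T'}. enat m)"

text \<open>Sequences are lists, but their positions are counted from 1.\<close>

definition entry :: "'a list \<Rightarrow> nat \<Rightarrow> 'a" where
  "entry xs t = xs ! (t - 1)"

text \<open>For \<open>1 \<le> i < j < k\<close> none of the natural-number subtractions below is truncated.\<close>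

definition apply_transposition :: "nat \<Rightarrow> nat \<Rightarrow> nat \<Rightarrow> 'a list \<Rightarrow> 'a list" where
  "apply_transposition i j k \<sigma> =
     (let q = k + i - j in
      map (\<lambda>t. if t < i then entry \<sigma> t
               else if t < q then entry \<sigma> (t + j - i)
               else if t < k then entry \<sigma> (t + j - k)
               else entry \<sigma> t)
        [1..<Suc (length \<sigma>)])"

definition one_transposition :: "nat \<Rightarrow> nat \<Rightarrow> nat \<Rightarrow> bool" where
  "one_transposition i j k \<longleftrightarrow> j = i + 1 \<or> k = j + 1"

definition tree_transposition :: "nat \<Rightarrow> nat \<Rightarrow> nat \<Rightarrow> nat \<Rightarrow> bool" where
  "tree_transposition n i j k \<longleftrightarrow>
     (\<exists>T\<^sub>1 T\<^sub>2 :: full_tree. size T\<^sub>1 = n \<and> size T\<^sub>2 = n \<and> rotation_distance T\<^sub>1 T\<^sub>2 = 1 \<and>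
        apply_transposition i j k (associated_permutation T\<^sub>1) = associated_permutation T\<^sub>2)"

end

theory Submission
  imports Defs "HOL-Library.Tree_Multiset"
begin

text \<open>A right rotation at \<open>a\<close> with left child \<open>b\<close>, whose subtrees are \<open>C\<close> and \<open>D\<close>, keeps
  all in-order labels and turns the pre-order factor \<open>a (b C) D E\<close> into \<open>(b C) a D E\<close>: it moves
  the single entry \<open>a\<close> past a block. A left rotation moves it back. As a
  permutation has no repeated entry, a transposition is determined by its effect on it, so only
  1-transpositions arise; since the size of \<open>C\<close> and the context of the rotation are arbitrary,
  all of them do.\<close>

text \<open>The index map of the transposition, separated from the sequence it acts on, so that
  comparing two transpositions becomes arithmetic on positions.\<close>

definition source_position :: "nat \<Rightarrow> nat \<Rightarrow> nat \<Rightarrow> nat \<Rightarrow> nat" where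
  "source_position i j k t =
     (if t < i then t else if t < k + i - j then t + j - i else if t < k then t + j - k else t)"

lemma length_apply_transposition [simp]: "length (apply_transposition i j k \<sigma>) = length \<sigma>"
  by (simp add: apply_transposition_def Let_def del: upt_Suc)

lemma entry_apply_transposition:
  assumes "1 \<le> t" "t \<le> length \<sigma>"
  shows "entry (apply_transposition i j k \<sigma>) t = entry \<sigma> (source_position i j k t)"
  using assms by (simp add: apply_transposition_def entry_def source_position_def Let_def del: upt_Suc)

lemma source_position_bounds:
  assumes "1 \<le> i" "i < j" "j < k" "k \<le> n + 1" "1 \<le> t" "t \<le> n"
  shows "1 \<le> source_position i j k t" "source_position i j k t \<le> n"
  using assms by (auto simp: source_position_def)

text \<open>Distinct entries force the two index maps to agree. The map determines the triple:
  \<open>i\<close> is the first position it moves, \<open>j\<close> is the image of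
  \<open>i\<close>, and \<open>k - 1\<close> is the last position it moves.\<close>

lemma apply_transposition_inject:
  assumes "distinct \<sigma>"
    and ijk: "1 \<le> i" "i < j" "j < k" "k \<le> length \<sigma> + 1"
    and ijk': "1 \<le> i'" "i' < j'" "j' < k'" "k' \<le> length \<sigma> + 1"
    and eq: "apply_transposition i j k \<sigma> = apply_transposition i' j' k' \<sigma>"
  shows "i = i' \<and> j = j' \<and> k = k'"
proof -
  have same: "source_position i j k t = source_position i' j' k' t"
    if t: "1 \<le> t" "t \<le> length \<sigma>" for t
  proof -
    have "entry \<sigma> (source_position i j k t) = entry \<sigma> (source_position i' j' k' t)"
      using eq entry_apply_transposition[OF t] by metis
    then show ?thesis
      using source_position_bounds[OF ijk t] source_position_bounds[OF ijk' t] \<open>distinct \<sigma>\<close>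
      by (auto simp: entry_def nth_eq_iff_index_eq)
  qed
  have i: "i = i'"
    using same[of i] same[of i'] ijk ijk'
    by (cases i i' rule: linorder_cases) (auto simp: source_position_def split: if_splits)
  have j: "j = j'"
    using same[of i] i ijk ijk' by (auto simp: source_position_def split: if_splits)
  have last: "source_position i j k (k - 1) = source_position i j k' (k - 1)"
    "source_position i j k (k' - 1) = source_position i j k' (k' - 1)"
    using same[of "k - 1"] same[of "k' - 1"] i j ijk ijk' by simp_all
  \<comment> \<open>If \<open>k\<close> and \<open>k'\<close> differed, the larger of
    \<open>k - 1\<close> and \<open>k' - 1\<close> would be moved by one map and fixed by the
    other.\<close>
  have "k = k'"
  proof (cases k k' rule: linorder_cases)
    case less
    with last(2) i j ijk ijk' show ?thesis
      by (simp add: source_position_def split: if_splits)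
  next
    case greater
    with last(1) i j ijk ijk' show ?thesis
      by (simp add: source_position_def split: if_splits)
  qed
  with i j show ?thesis by blast
qed

text \<open>Passes from positions to blocks: the three indices are the positions, counted from 1, at
  which \<open>ys\<close>, \<open>zs\<close> and \<open>ws\<close> begin.\<close>

lemma apply_transposition_append:
  assumes "ys \<noteq> []" "zs \<noteq> []"
  shows "apply_transposition (length xs + 1) (length xs + length ys + 1)
           (length xs + length ys + length zs + 1) (xs @ ys @ zs @ ws) = xs @ zs @ ys @ ws"
    (is "apply_transposition ?i ?j ?k ?\<sigma> = ?\<tau>")
proof (rule nth_equalityI)
  fix t assume "t < length (apply_transposition ?i ?j ?k ?\<sigma>)"
  then have t: "t < length xs + length ys + length zs + length ws" by simp
  have "apply_transposition ?i ?j ?k ?\<sigma> ! t = entry ?\<sigma> (source_position ?i ?j ?k (Suc t))"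
    using entry_apply_transposition[of "Suc t" ?\<sigma> ?i ?j ?k] t by (simp add: entry_def)
  also have "\<dots> = ?\<tau> ! t"
    using assms t by (auto simp: entry_def source_position_def nth_append add_ac)
  finally show "apply_transposition ?i ?j ?k ?\<sigma> ! t = ?\<tau> ! t" .
qed simp

lemma size_right_rotation: "right_rotation T T' \<Longrightarrow> size T' = size T"
  by (induction rule: right_rotation.induct) auto

lemma right_rotation_neq: "right_rotation T T' \<Longrightarrow> T \<noteq> T'"
proof (induction rule: right_rotation.induct)
  case (at_root C b D a E)
  show ?case
    \<comment> \<open>Equality would give \<open>Node C b D = C\<close>, against the sizes.\<close>
    by (auto dest: arg_cong[where f = size])
qed auto

lemma size_label_from [simp]: "size (label_from m t) = size t"
  by (induction t arbitrary: m) auto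

lemma length_associated_permutation [simp]: "length (associated_permutation t) = size t"
  by (simp add: associated_permutation_def)

lemma distinct_associated_permutation: "distinct (associated_permutation t)"
proof -
  have "distinct (inorder (label_from 1 t))"
    by (simp only: inorder_label_from distinct_upt)
  moreover have "mset (preorder (label_from 1 t)) = mset (inorder (label_from 1 t))"
    by (simp only: mset_preorder mset_inorder)
  ultimately show ?thesis
    unfolding associated_permutation_def by (metis mset_eq_imp_distinct_iff)
qed

text \<open>A context only lengthens \<open>xs\<close> or \<open>ws\<close>. The offset
  \<open>m\<close> is general because a right subtree is numbered from a shifted start.\<close>

lemma preorder_right_rotation:
  assumes "right_rotation T T'"
  shows "\<exists>xs a zs ws. zs \<noteq> [] \<and> preorder (label_from m T) = xs @ [a] @ zs @ ws \<and>
           preorder (label_from m T') = xs @ zs @ [a] @ ws"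
  using assms
proof (induction arbitrary: m rule: right_rotation.induct)
  case (at_root C b D a E)
  \<comment> \<open>The moved entry is the label of \<open>a\<close>; the block it passes is the
    label of \<open>b\<close> followed by \<open>C\<close>, hence nonempty.\<close>
  show ?case
    by (rule exI[of _ "[]"], rule exI[of _ "m + size C + size D + 1"],
        rule exI[of _ "(m + size C) # preorder (label_from m C)"]) (simp add: ac_simps)
next
  case (in_left l l' a r)
  obtain xs c zs ws where "zs \<noteq> []" "preorder (label_from m l) = xs @ [c] @ zs @ ws"
    "preorder (label_from m l') = xs @ zs @ [c] @ ws"
    using in_left.IH by blast
  \<comment> \<open>Since \<open>l\<close> and \<open>l'\<close> have equal size, the root and
    \<open>r\<close> keep their labels.\<close>
  then show ?case
    using size_right_rotation[OF in_left.hyps]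
    by (intro exI[of _ "(m + size l) # xs"] exI[of _ c] exI[of _ zs]
        exI[of _ "ws @ preorder (label_from (Suc (m + size l)) r)"]) simp
next
  case (in_right r r' l a)
  obtain xs c zs ws where "zs \<noteq> []"
    "preorder (label_from (Suc (m + size l)) r) = xs @ [c] @ zs @ ws"
    "preorder (label_from (Suc (m + size l)) r') = xs @ zs @ [c] @ ws"
    using in_right.IH by blast
  then show ?case
    by (intro exI[of _ "(m + size l) # preorder (label_from m l) @ xs"] exI[of _ c]
        exI[of _ zs] exI[of _ ws]) simp
qed

lemma rotation_distance_eq_1_iff: "rotation_distance T T' = 1 \<longleftrightarrow> rotation T T'"
proof
  assume dist: "rotation_distance T T' = 1"
  let ?M = "enat ` {m. (rotation ^^ m) T T'}"
  \<comment> \<open>An empty set would have infimum \<infinity>; a nonempty one attains its infimum,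
    so a path of exactly one step exists.\<close>
  have "?M \<noteq> {}"
    using dist by (auto simp: rotation_distance_def Inf_enat_def one_enat_def split: if_splits)
  then have "Inf ?M \<in> ?M"
    by (auto simp: Inf_enat_def intro: LeastI)
  then show "rotation T T'"
    using dist by (auto simp: rotation_distance_def one_enat_def)
next
  assume rot: "rotation T T'"
  \<comment> \<open>Zero steps are excluded because a rotation changes the tree.\<close>
  have "1 \<le> enat m" if "(rotation ^^ m) T T'" for m
    using that rot right_rotation_neq by (cases m) (auto simp: one_enat_def rotation_def)
  moreover have "(rotation ^^ 1) T T'"
    using rot by (simp add: eq_OO)
  ultimately show "rotation_distance T T' = 1"
    unfolding rotation_distance_def
    by (intro antisym INF_greatest INF_lower2[of 1]) (auto simp: one_enat_def)
qed

lemma rotation_transposition_is_one_transposition: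
  assumes "rotation T T'"
    and ijk: "1 \<le> i" "i < j" "j < k" "k \<le> size T + 1"
    and eq: "apply_transposition i j k (associated_permutation T) = associated_permutation T'"
  shows "one_transposition i j k"
proof -
  \<comment> \<open>One form for both directions: the single entry is \<open>ys\<close> for a right
    rotation and \<open>zs\<close> for a left one.\<close>
  obtain xs ys zs ws where
    T: "associated_permutation T = xs @ ys @ zs @ ws" and
    T': "associated_permutation T' = xs @ zs @ ys @ ws" and
    ne: "ys \<noteq> []" "zs \<noteq> []" and one: "length ys = 1 \<or> length zs = 1"
  proof (cases "right_rotation T T'")
    case True
    from preorder_right_rotation[OF this, of 1] show thesis
      using that[where ys = "[_]"] by (auto simp: associated_permutation_def)
  next
    case False
    then have "right_rotation T' T" using assms(1) by (simp add: rotation_def)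
    from preorder_right_rotation[OF this, of 1] show thesis
      using that[where zs = "[_]"] by (auto simp: associated_permutation_def)
  qed
  have len: "size T = length xs + length ys + length zs + length ws"
    using arg_cong[OF T, of length] by simp
  have "i = length xs + 1 \<and> j = length xs + length ys + 1 \<and>
      k = length xs + length ys + length zs + 1"
  proof (rule apply_transposition_inject[OF distinct_associated_permutation[of T]])
    show "apply_transposition i j k (associated_permutation T) =
        apply_transposition (length xs + 1) (length xs + length ys + 1)
          (length xs + length ys + length zs + 1) (associated_permutation T)"
      using eq T T' apply_transposition_append[OF ne] by simp
  qed (use ijk ne len in auto)
  with one show ?thesis
    by (auto simp: one_transposition_def)
qed

text \<open>A right spine puts \<open>p\<close> entries before \<open>t\<close> in pre-order, so a
  rotation can be placed at any position; over \<open>Leaf\<close> it is a tree of prescribed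
  size.\<close>

fun right_comb :: "nat \<Rightarrow> full_tree \<Rightarrow> full_tree" where
  "right_comb 0 t = t"
| "right_comb (Suc p) t = Node Leaf () (right_comb p t)"

lemma size_right_comb [simp]: "size (right_comb p t) = p + size t"
  by (induction p) auto

lemma right_rotation_right_comb:
  "right_rotation t t' \<Longrightarrow> right_rotation (right_comb p t) (right_comb p t')"
  by (induction p) (auto intro: in_right)

lemma preorder_right_comb:
  "preorder (label_from m (right_comb p t)) = [m..<m + p] @ preorder (label_from (m + p) t)"
proof (induction p arbitrary: m)
  case (Suc p)
  have "m # [Suc m..<Suc m + p] = [m..<m + Suc p]"
    by (simp add: upt_conv_Cons del: upt_Suc)
  with Suc show ?case by (simp del: upt_Suc)
qed simp

text \<open>The witnesses have \<open>p\<close> nodes before the rotated one in pre-order; the parameters \<open>c\<close> and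
  \<open>e\<close> are the sizes of \<open>C\<close> and \<open>E\<close>, and \<open>D\<close> is a leaf.\<close>

lemma right_rotation_witness:
  fixes p c e :: nat
  obtains T T' :: full_tree and xs a zs ws where
    "right_rotation T T'" "size T = p + c + e + 2"
    "associated_permutation T = xs @ [a] @ zs @ ws"
    "associated_permutation T' = xs @ zs @ [a] @ ws"
    "length xs = p" "length zs = c + 1"
proof -
  define C where "C = right_comb c Leaf"
  define E where "E = right_comb e Leaf"
  let ?T = "right_comb p (Node (Node C () Leaf) () E)"
  let ?T' = "right_comb p (Node C () (Node Leaf () E))"
  have C: "size C = c" and E: "size E = e"
    by (simp_all add: C_def E_def)
  show thesis
  proof (rule that)
    show "right_rotation ?T ?T'"
      by (intro right_rotation_right_comb at_root)
    show "size ?T = p + c + e + 2"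
      using C E by simp
    \<comment> \<open>In in-order the spine takes the labels up to \<open>p\<close>, then come
      \<open>C\<close>, its parent \<open>1 + p + c\<close>, the rotated node
      \<open>p + c + 2\<close>, and \<open>E\<close>.\<close>
    let ?xs = "[1..<1 + p]" and ?a = "p + c + 2"
      and ?zs = "(1 + p + c) # preorder (label_from (1 + p) C)"
      and ?ws = "preorder (label_from (p + c + 3) E)"
    show "associated_permutation ?T = ?xs @ [?a] @ ?zs @ ?ws"
      using C by (simp add: associated_permutation_def preorder_right_comb numeral_eq_Suc del: upt_Suc)
    show "associated_permutation ?T' = ?xs @ ?zs @ [?a] @ ?ws"
      using C by (simp add: associated_permutation_def preorder_right_comb numeral_eq_Suc del: upt_Suc)
    show "length ?xs = p" "length ?zs = c + 1"
      using C by simp_all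
  qed
qed

theorem theorem6:
  fixes n i j k :: nat
  assumes "n \<ge> 1" and "1 \<le> i" and "i < j" and "j < k" and "k \<le> n + 1"
  shows "tree_transposition n i j k \<longleftrightarrow> one_transposition i j k"
proof
  assume "tree_transposition n i j k"
  then show "one_transposition i j k"
    using rotation_transposition_is_one_transposition assms
    by (auto simp: tree_transposition_def rotation_distance_eq_1_iff)
next
  assume one: "one_transposition i j k"
  \<comment> \<open>The two swapped blocks have total length \<open>k - i = 1 + (c + 1)\<close>,
    whence \<open>c = k - i - 2\<close>, not truncated as \<open>i < j < k\<close>;
    \<open>n + 1 - k\<close> entries follow them.\<close>
  obtain T T' :: full_tree and xs a zs ws where rot: "right_rotation T T'"
    and size: "size T = (i - 1) + (k - i - 2) + (n + 1 - k) + 2"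
    and T: "associated_permutation T = xs @ [a] @ zs @ ws"
    and T': "associated_permutation T' = xs @ zs @ [a] @ ws"
    and xs: "length xs = i - 1" and zs: "length zs = (k - i - 2) + 1"
    by (rule right_rotation_witness)
  have n: "size T = n" "size T' = n"
    using size size_right_rotation[OF rot] assms by simp_all
  have "zs \<noteq> []" using zs by auto
  have pos: "i = length xs + 1" "k = length xs + 1 + length zs + 1"
    using xs zs assms by simp_all
  from one consider "j = i + 1" | "k = j + 1"
    by (auto simp: one_transposition_def)
  then show "tree_transposition n i j k"
  proof cases
    case 1
    then have "apply_transposition i j k (associated_permutation T) = associated_permutation T'"
      using apply_transposition_append[of "[a]" zs xs ws] \<open>zs \<noteq> []\<close> T T' pos by simp
    with n rot show ?thesis
      unfolding tree_transposition_def rotation_distance_eq_1_iff rotation_def by blast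
  next
    \<comment> \<open>The same pair of trees read backwards, as a left rotation.\<close>
    case 2
    then have "apply_transposition i j k (associated_permutation T') = associated_permutation T"
      using apply_transposition_append[of zs "[a]" xs ws] \<open>zs \<noteq> []\<close> T T' pos by simp
    with n rot show ?thesis
      unfolding tree_transposition_def rotation_distance_eq_1_iff rotation_def by blast
  qed
qed

end
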